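(* Let $G$ and $H$ be regular graphs with vertex degrees $d_G$ and $d_H$, respectively, and put $d_{G\boxtimes H}=d_G+d_H+d_Gd_H$. Let $x_1,x_2$ be adjacent vertices of $G$ and $y_1,y_2$ adjacent vertices of $H$, with $N_G[x_1]\neq N_G[x_2]$ and $N_H[y_1]\neq N_H[y_2]$. Then \[ \kappa_{\mathrm{LLY}}((x_1,y_1),(x_2,y_2))\ \ge\ \frac{d_H(d_G+1)}{d_{G\boxtimes H}}\kappa_{\mathrm{LLY}}(y_1,y_2)+\frac{d_G(d_H+1)}{d_{G\boxtimes H}}\kappa_{\mathrm{LLY}}(x_1,x_2)-X, \] where \[ X=1-\frac{|R_{x_1}(x_1,x_2)|\,|R_{y_1}(y_1,y_2)|-1}{d_{G\boxtimes H}}, \] the left-hand curvature is computed in $G\boxtimes H$, and the curvatures on the right in $G$ and $H$ respectively.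
   Context: Graphs are simple, undirected and locally finite; $d(\cdot,\cdot)$ is the shortest-path distance, $N(x)$ the set of neighbours of $x$ and $N[x]=N(x)\cup\{x\}$. For an edge $xy$: $\triangle(x,y)=N(x)\cap N(y)$ and $R_x(x,y)=N(x)\setminus(\triangle(x,y)\cup\{y\})$. For $x\in V$ and $\alpha\in[0,1]$, $\mu_x^\alpha(x)=\alpha$, $\mu_x^\alpha(y)=(1-\alpha)/d_x$ for $y\in N(x)$, and $0$ otherwise. The Wasserstein distance between probability measures $\mu_1,\mu_2$ on $V$ is $W(\mu_1,\mu_2)=\inf_\pi\sum_{x,y}d(x,y)\pi(x,y)$ over all $\pi:V\times V\to[0,1]$ with marginals $\mu_1,\mu_2$. For distinct $x,y$, $\kappa_\alpha(x,y)=1-W(\mu_x^\alpha,\mu_y^\alpha)/d(x,y)$, and the Lin--Lu--Yau curvature is $\kappa_{\mathrm{LLY}}(x,y)=\lim_{\alpha\to1}\kappa_\alpha(x,y)/(1-\alpha)$. The strong product $G\boxtimes H$ has vertex set $V(G)\times V(H)$, with distinct $(x_1,y_1),(x_2,y_2)$ adjacent iff $x_2\in N_G[x_1]$ and $y_2\in N_H[y_1]$. *)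

theory Defs
  imports
    "HOL-Analysis.Analysis"
    "Graph_Theory.Pair_Digraph"
    "Graph_Theory.Shortest_Path"
begin

text \<open>
  A simple undirected graph, possibly infinite and possibly disconnected, is a symmetric loop-free
  \<^typ>\<open>'a pair_pre_digraph\<close>, i.e. an instance of \<^locale>\<open>pair_bidirected_digraph\<close>. An edge
  \<open>xy\<close> is represented by the two arcs \<open>(x, y)\<close> and \<open>(y, x)\<close>.
\<close>

definition neighbors :: "'a pair_pre_digraph \<Rightarrow> 'a \<Rightarrow> 'a set" where
  "neighbors G x = {y. (x, y) \<in> parcs G}"

definition closed_neighbors :: "'a pair_pre_digraph \<Rightarrow> 'a \<Rightarrow> 'a set" where
  "closed_neighbors G x = insert x (neighbors G x)"

locale locally_finite_graph = pair_bidirected_digraph G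
  for G :: "'a pair_pre_digraph" +
  assumes locally_finite: "x \<in> pverts G \<Longrightarrow> finite (neighbors G x)"

locale regular_graph = locally_finite_graph G
  for G :: "'a pair_pre_digraph" and d :: nat +
  assumes regular: "x \<in> pverts G \<Longrightarrow> card (neighbors G x) = d"

definition triangles :: "'a pair_pre_digraph \<Rightarrow> 'a \<Rightarrow> 'a \<Rightarrow> 'a set" where
  "triangles G x y = neighbors G x \<inter> neighbors G y"

text \<open>\<open>rest G x y\<close> is the set \<open>R\<^sub>x(x, y)\<close>; the set \<open>R\<^sub>y(x, y)\<close> is \<open>rest G y x\<close>.\<close>

definition rest :: "'a pair_pre_digraph \<Rightarrow> 'a \<Rightarrow> 'a \<Rightarrow> 'a set" where
  "rest G x y = neighbors G x - (triangles G x y \<union> {y})"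

text \<open>The distance takes the value \<open>\<infinity>\<close> on vertices of different components.\<close>

definition graph_dist :: "'a pair_pre_digraph \<Rightarrow> 'a \<Rightarrow> 'a \<Rightarrow> ereal" where
  "graph_dist G x y = wf_digraph.\<mu> (with_proj G) (\<lambda>_. 1) x y"

definition walk_measure :: "'a pair_pre_digraph \<Rightarrow> real \<Rightarrow> 'a \<Rightarrow> 'a \<Rightarrow> real" where
  "walk_measure G \<alpha> x y =
     (if y = x then \<alpha>
      else if y \<in> neighbors G x then (1 - \<alpha>) / real (card (neighbors G x))
      else 0)"

definition transport_plans ::
    "'a pair_pre_digraph \<Rightarrow> ('a \<Rightarrow> real) \<Rightarrow> ('a \<Rightarrow> real) \<Rightarrow> ('a \<times> 'a \<Rightarrow> real) set" where
  "transport_plans G \<mu>\<^sub>1 \<mu>\<^sub>2 =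
     {\<pi>. (\<forall>x\<in>pverts G. \<forall>y\<in>pverts G. \<pi> (x, y) \<in> {0..1}) \<and>
         (\<forall>x\<in>pverts G. ((\<lambda>y. \<pi> (x, y)) has_sum \<mu>\<^sub>1 x) (pverts G)) \<and>
         (\<forall>y\<in>pverts G. ((\<lambda>x. \<pi> (x, y)) has_sum \<mu>\<^sub>2 y) (pverts G))}"

text \<open>
  The transport cost is summed in \<^typ>\<open>ennreal\<close>, so that it exists for every plan and a plan that
  moves no mass between two components pays nothing for that pair (\<open>\<infinity> * 0 = 0\<close>).
\<close>

definition wasserstein :: "'a pair_pre_digraph \<Rightarrow> ('a \<Rightarrow> real) \<Rightarrow> ('a \<Rightarrow> real) \<Rightarrow> ennreal" where
  "wasserstein G \<mu>\<^sub>1 \<mu>\<^sub>2 =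
     (INF \<pi>\<in>transport_plans G \<mu>\<^sub>1 \<mu>\<^sub>2.
        \<Sum>\<^sub>\<infinity>(x, y)\<in>pverts G \<times> pverts G. e2ennreal (graph_dist G x y) * ennreal (\<pi> (x, y)))"

text \<open>
  For \<open>\<alpha> \<in> [0, 1]\<close> and distinct vertices of one component both the distance and the Wasserstein
  distance are finite; only then are the conversions to \<^typ>\<open>real\<close> meaningful.
\<close>

definition alpha_curvature :: "'a pair_pre_digraph \<Rightarrow> real \<Rightarrow> 'a \<Rightarrow> 'a \<Rightarrow> real" where
  "alpha_curvature G \<alpha> x y =
     1 - enn2real (wasserstein G (walk_measure G \<alpha> x) (walk_measure G \<alpha> y))
           / real_of_ereal (graph_dist G x y)"

text \<open>The limit is one-sided because the measures are probability measures only for \<open>\<alpha> \<le> 1\<close>.\<close>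

definition LLY_curvature :: "'a pair_pre_digraph \<Rightarrow> 'a \<Rightarrow> 'a \<Rightarrow> real" where
  "LLY_curvature G x y = Lim (at_left 1) (\<lambda>\<alpha>. alpha_curvature G \<alpha> x y / (1 - \<alpha>))"

definition strong_product ::
    "'a pair_pre_digraph \<Rightarrow> 'b pair_pre_digraph \<Rightarrow> ('a \<times> 'b) pair_pre_digraph" where
  "strong_product G H =
     \<lparr>pverts = pverts G \<times> pverts H,
      parcs = {((x1, y1), (x2, y2)) | x1 y1 x2 y2.
        x1 \<in> pverts G \<and> y1 \<in> pverts H \<and> (x1, y1) \<noteq> (x2, y2) \<and>
        x2 \<in> closed_neighbors G x1 \<and> y2 \<in> closed_neighbors H y1}\<rparr>"

end

theory Submission
  imports Defs
begin

text \<open>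
  For an edge \<open>xy\<close> of a \<open>d\<close>-regular graph, \<open>\<kappa>\<^sub>L\<^sub>L\<^sub>Y(x, y) = (d + 1 - A) / d\<close>, where \<open>A\<close> is the least
  cost of a bijection \<open>N[x] \<rightarrow> N[y]\<close>. It may be taken to fix the common points, so that only
  \<open>R\<^sub>x(x, y)\<close> is transported. Such a bijection, with the excess mass moved from \<open>x\<close> to \<open>y\<close>, is a
  transport plan, which bounds the Wasserstein distance from above; a 1-Lipschitz function dual to
  the optimal bijection and dropping by 1 from \<open>x\<close> to \<open>y\<close> gives the matching lower bound.

  In the strong product, distances are at most maxima of the distances in the factors. The product
  of optimal bijections for the factors, of costs \<open>A\<close> and \<open>B\<close>, therefore costs at most
  \<open>(d\<^sub>H + 1) A + (d\<^sub>G + 1) B - |R\<^bsub>x\<^sub>1\<^esub>| |R\<^bsub>y\<^sub>1\<^esub>|\<close>: the cardinality term arises because \<open>max s t \<le> s + t - 1\<close>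
  on the pairs where both coordinates move.
\<close>

section \<open>Dual potentials of optimal assignments\<close>

fun path_weight :: "('a \<Rightarrow> 'a \<Rightarrow> real) \<Rightarrow> 'a list \<Rightarrow> real" where
  "path_weight w (a # b # L) = w a b + path_weight w (b # L)"
| "path_weight w _ = 0"

lemma path_weight_append:
  "path_weight w (K @ a # L) = path_weight w (K @ [a]) + path_weight w (a # L)"
proof (induction K)
  case (Cons b K)
  then show ?case by (cases K) auto
qed simp

text \<open>A cycle through distinct points extends by the identity to a permutation, and since
  loops weigh 0 the points off the cycle contribute nothing. The image of the last point is recorded
  so that the induction can lengthen the cycle.\<close>

lemma path_weight_cycle:
  assumes "finite X" "distinct (a # L)" "set (a # L) \<subseteq> X" "\<And>u. w u u = 0"
  shows "\<exists>\<tau>. \<tau> permutes set (a # L) \<and> \<tau> (last (a # L)) = a \<and>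
    (\<Sum>u\<in>X. w u (\<tau> u)) = path_weight w (a # L) + w (last (a # L)) a"
  using assms(2,3)
proof (induction L arbitrary: a)
  case Nil
  show ?case
    by (rule exI[of _ id]) (use assms(4) permutes_id in auto)
next
  case (Cons b L)
  let ?l = "last (b # L)"
  obtain \<tau> where \<tau>: "\<tau> permutes set (b # L)" "\<tau> ?l = b"
      "(\<Sum>u\<in>X. w u (\<tau> u)) = path_weight w (b # L) + w ?l b"
    using Cons.IH[of b] Cons.prems by auto
  \<comment> \<open>The transposition splices \<open>a\<close> into the closing arc: the last point
    now goes to \<open>a\<close> and \<open>a\<close> to \<open>b\<close>. All other images are
    unchanged.\<close>
  define \<tau>' where "\<tau>' = Transposition.transpose a b \<circ> \<tau>"
  have a: "a \<notin> set (b # L)" "a \<in> X" and l: "?l \<in> set (b # L)" "?l \<in> X"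
    using Cons.prems last_in_set[of "b # L"] by auto
  have ne: "a \<noteq> ?l" using a l by metis
  have \<tau>a: "\<tau> a = a" using \<tau>(1) a(1) by (simp add: permutes_def)
  have inj: "inj \<tau>" using \<tau>(1) by (rule permutes_inj)
  have eq: "\<tau>' u = \<tau> u" if "u \<noteq> a" "u \<noteq> ?l" for u
  proof -
    have "\<tau> u \<noteq> a" "\<tau> u \<noteq> b"
      using inj \<tau>a \<tau>(2) that unfolding inj_def by metis+
    then show ?thesis by (simp add: \<tau>'_def Transposition.transpose_def)
  qed
  have \<tau>'l: "\<tau>' ?l = a" and \<tau>'a: "\<tau>' a = b"
    using \<tau>(2) \<tau>a by (simp_all add: \<tau>'_def)
  have split: "(\<Sum>u\<in>X. h u) = h a + h ?l + (\<Sum>u\<in>X - {a, ?l}. h u)" for h :: "_ \<Rightarrow> real"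
    using sum.subset_diff[of "{a, ?l}" X h] a l ne \<open>finite X\<close> by simp
  have "(\<Sum>u\<in>X - {a, ?l}. w u (\<tau>' u)) = (\<Sum>u\<in>X - {a, ?l}. w u (\<tau> u))"
    by (rule sum.cong) (auto simp: eq)
  then have "(\<Sum>u\<in>X. w u (\<tau>' u)) = path_weight w (a # b # L) + w ?l a"
    using \<tau>(3) split[of "\<lambda>u. w u (\<tau> u)"] split[of "\<lambda>u. w u (\<tau>' u)"]
    unfolding \<tau>'l \<tau>'a \<tau>(2) \<tau>a assms(4) by simp
  moreover have "\<tau>' permutes set (a # b # L)"
    unfolding \<tau>'_def
    by (intro permutes_compose permutes_swap_id) (auto intro: permutes_subset[OF \<tau>(1)])
  ultimately show ?case using \<tau>'l by auto
qed

text \<open>The potential of \<open>u\<close> is the least weight of a path without repetitions that starts at \<open>u\<close>;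
  the hypothesis rules out negative cycles.\<close>

lemma exists_path_potential:
  assumes "finite X" "\<And>u. w u u = 0"
    and nonneg: "\<And>\<tau>. \<tau> permutes X \<Longrightarrow> 0 \<le> (\<Sum>u\<in>X. w u (\<tau> u))"
  shows "\<exists>p :: 'a \<Rightarrow> real. \<forall>u\<in>X. \<forall>v\<in>X. p u \<le> w u v + p v"
proof -
  define P where "P u = {L. set L \<subseteq> X \<and> distinct L \<and> L \<noteq> [] \<and> hd L = u}" for u
  define p where "p u = Min (path_weight w ` P u)" for u
  have fin: "finite (P u)" for u
    by (rule finite_subset[OF _ finite_subset_distinct[OF \<open>finite X\<close>]]) (auto simp: P_def)
  have le: "p u \<le> path_weight w L" if "L \<in> P u" for L u
    unfolding p_def using fin that by auto
  have "p u \<le> w u v + p v" if uv: "u \<in> X" "v \<in> X" for u v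
  proof -
    have "[v] \<in> P v" using uv by (simp add: P_def)
    then have "p v \<in> path_weight w ` P v"
      unfolding p_def using fin by (intro Min_in) auto
    then obtain L where L: "L \<in> P v" "p v = path_weight w L" by auto
    then obtain L' where L': "L = v # L'" by (cases L) (auto simp: P_def)
    show ?thesis
    proof (cases "u \<in> set L")
      case False
      then have "u # L \<in> P u" using L uv by (auto simp: P_def)
      from le[OF this] show ?thesis using L L' by simp
    next
      case True
      then obtain K M where KM: "L = K @ u # M" by (meson split_list)
      \<comment> \<open>The minimal path from \<open>v\<close> runs through \<open>u\<close>. Its
        initial piece up to \<open>u\<close>, closed by the arc from \<open>u\<close> to
        \<open>v\<close>, is a cycle and so has nonnegative weight; the remaining piece is a
        candidate for \<open>p u\<close>.\<close>
      have "0 \<le> path_weight w (K @ [u]) + w u v"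
      proof -
        obtain K' where K': "K @ [u] = v # K'" using KM L' by (cases K) auto
        have dis: "distinct (K @ [u])" "set (K @ [u]) \<subseteq> X"
          using L(1) KM by (auto simp: P_def)
        have "last (v # K') = u" unfolding K'[symmetric] by simp
        then obtain \<tau> where "\<tau> permutes set (v # K')"
            "(\<Sum>u\<in>X. w u (\<tau> u)) = path_weight w (v # K') + w u v"
          using path_weight_cycle[OF \<open>finite X\<close>, of v K' w] assms(2) dis unfolding K' by metis
        then show ?thesis
          using nonneg[of \<tau>] permutes_subset dis unfolding K' by metis
      qed
      moreover have "u # M \<in> P u" using L(1) KM by (auto simp: P_def)
      ultimately show ?thesis
        using le[of "u # M" u] path_weight_append[of w K u M] L(2) KM by simp
    qed
  qed
  then show ?thesis by blast
qed

text \<open>Duality for the assignment problem: optimality of \<open>\<sigma>\<close> excludes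
  negative cycles of exchanges, so a path potential on \<open>X\<close> exists, and it extends to a
  Lipschitz function on the whole type.\<close>

lemma exists_dual_potential:
  fixes D :: "'a \<Rightarrow> 'a \<Rightarrow> real"
  assumes "finite X" "X \<noteq> {}" and "\<And>u. D u u = 0" "\<And>u v. D u v = D v u"
    and tri: "\<And>u v z. D u z \<le> D u v + D v z"
    and opt: "\<And>\<tau>. \<tau> permutes X \<Longrightarrow> (\<Sum>u\<in>X. D u (\<sigma> u)) \<le> (\<Sum>u\<in>X. D u (\<sigma> (\<tau> u)))"
  shows "\<exists>f. (\<forall>a b. f a - f b \<le> D a b) \<and> (\<forall>u\<in>X. f u - f (\<sigma> u) = D u (\<sigma> u))"
proof -
  \<comment> \<open>The weight is the change in cost when the target \<open>\<sigma> v\<close> is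
    served from \<open>u\<close> instead of \<open>v\<close>. Along a permutation
    \<open>\<tau>\<close> these changes add up to the cost of \<open>\<sigma> \<circ> \<tau>\<close>
    minus that of \<open>\<sigma>\<close>.\<close>
  define w where "w u v = D u (\<sigma> v) - D v (\<sigma> v)" for u v
  have "0 \<le> (\<Sum>u\<in>X. w u (\<tau> u))" if "\<tau> permutes X" for \<tau>
  proof -
    have "(\<Sum>u\<in>X. D (\<tau> u) (\<sigma> (\<tau> u))) = (\<Sum>u\<in>X. D u (\<sigma> u))"
      using sum.permute[OF that, of "\<lambda>u. D u (\<sigma> u)"] by (simp add: o_def)
    then show ?thesis using opt[OF that] by (simp add: w_def sum_subtractf)
  qed
  then obtain p where p: "\<And>u v. u \<in> X \<Longrightarrow> v \<in> X \<Longrightarrow> p u \<le> w u v + p v"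
    using exists_path_potential[OF \<open>finite X\<close>, of w] by (auto simp: w_def)
  \<comment> \<open>Each \<open>g _ u\<close> is a cone with apex \<open>\<sigma> u\<close> that
    takes the value \<open>p u\<close> at \<open>u\<close>; a minimum of such cones is Lipschitz.
    The potential inequality says that no cone lies below \<open>p u\<close> at
    \<open>u\<close>.\<close>
  define g where "g z u = p u - D u (\<sigma> u) + D z (\<sigma> u)" for z u
  define f where "f z = Min (g z ` X)" for z
  have le: "f z \<le> g z u" if "u \<in> X" for z u
    unfolding f_def using that assms(1) by auto
  have ex: "\<exists>u\<in>X. f z = g z u" for z
  proof -
    have "f z \<in> g z ` X" unfolding f_def using assms(1,2) by (intro Min_in) auto
    then show ?thesis by auto
  qed
  have lip: "f a - f b \<le> D a b" for a b
  proof -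
    obtain u where u: "u \<in> X" "f b = g b u" using ex by blast
    then show ?thesis using le[OF u(1), of a] tri[of a "\<sigma> u" b] by (simp add: g_def)
  qed
  have "f u - f (\<sigma> u) = D u (\<sigma> u)" if u: "u \<in> X" for u
  proof -
    obtain v where v: "v \<in> X" "f u = g u v" using ex by blast
    have "p u \<le> f u" using p[OF u v(1)] v(2) by (simp add: g_def w_def)
    moreover have "f (\<sigma> u) \<le> p u - D u (\<sigma> u)"
      using le[OF u, of "\<sigma> u"] assms(3) by (simp add: g_def)
    ultimately show ?thesis using lip[of u "\<sigma> u"] by simp
  qed
  with lip show ?thesis by blast
qed

section \<open>The truncated distance\<close>

text \<open>On vertices this is \<open>min (d(u, v)) 3\<close>. All the mass that has to be moved along an edge lies
  within distance 3, and unlike the distance itself this is a finite metric on the whole type,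
  whether or not the graph is connected.\<close>

definition near_dist :: "'a pair_pre_digraph \<Rightarrow> 'a \<Rightarrow> 'a \<Rightarrow> nat" where
  "near_dist G u v =
     (if u = v then 0 else if v \<in> neighbors G u then 1
      else if neighbors G u \<inter> neighbors G v \<noteq> {} then 2 else 3)"

lemma near_dist_le_3: "near_dist G u v \<le> 3"
  by (simp add: near_dist_def)

lemma near_dist_self [simp]: "near_dist G u u = 0"
  by (simp add: near_dist_def)

lemma near_dist_pos: "u \<noteq> v \<Longrightarrow> 1 \<le> near_dist G u v"
  by (simp add: near_dist_def)

lemma near_dist_le_1_iff: "near_dist G u v \<le> 1 \<longleftrightarrow> v \<in> closed_neighbors G u"
  by (auto simp: near_dist_def closed_neighbors_def)

context pair_bidirected_digraph
begin

lemma neighbors_sym: "u \<in> neighbors G v \<longleftrightarrow> v \<in> neighbors G u"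
  using arcs_symmetric by (auto simp: neighbors_def)

lemma closed_neighbors_sym: "u \<in> closed_neighbors G v \<longleftrightarrow> v \<in> closed_neighbors G u"
  using neighbors_sym by (auto simp: closed_neighbors_def)

lemma neighbors_irrefl: "u \<notin> neighbors G u"
  using no_loops' by (auto simp: neighbors_def)

lemma neighbors_in_verts: "u \<in> neighbors G v \<Longrightarrow> u \<in> pverts G"
  by (auto simp: neighbors_def dest: in_arcsD2)

lemma closed_neighbors_subset: "u \<in> pverts G \<Longrightarrow> closed_neighbors G u \<subseteq> pverts G"
  using neighbors_in_verts by (auto simp: closed_neighbors_def)

lemma near_dist_sym: "near_dist G u v = near_dist G v u"
  using neighbors_sym by (auto simp: near_dist_def)

text \<open>By the cap at 3, two positive terms can only fail to suffice if both are 1, and then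
  \<open>v\<close> is a common neighbour of \<open>u\<close> and \<open>z\<close>.\<close>

lemma near_dist_triangle: "near_dist G u z \<le> near_dist G u v + near_dist G v z"
  using neighbors_sym by (auto simp: near_dist_def)

lemma near_dist_le_2_iff:
  "near_dist G u v \<le> 2 \<longleftrightarrow> closed_neighbors G u \<inter> closed_neighbors G v \<noteq> {}"
  using neighbors_sym by (auto simp: near_dist_def closed_neighbors_def)

section \<open>Comparison with walks and the graph distance\<close>

lemma near_dist_le_awalk: "awalk u p v \<Longrightarrow> near_dist G u v \<le> length p"
proof (induction p arbitrary: u)
  case Nil
  then show ?case by (simp add: awalk_simps)
next
  case (Cons e p)
  obtain a b where e: "e = (a, b)" by (cases e)
  then have "b \<in> neighbors G u" "awalk b p v"
    using Cons.prems by (auto simp: awalk_simps neighbors_def)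
  moreover from this have "near_dist G u b \<le> 1" by (simp add: near_dist_def)
  ultimately show ?case using Cons.IH[of b] near_dist_triangle[of u v b] by simp
qed

lemma awalk_cost_one: "awalk_cost (\<lambda>_. 1) p = real (length p)"
  by (induction p) (auto simp: awalk_cost_def)

lemma near_dist_le_graph_dist: "ereal (real (near_dist G u v)) \<le> graph_dist G u v"
  unfolding graph_dist_def \<mu>_def
  by (rule INF_greatest) (auto simp: awalk_cost_one near_dist_le_awalk)

lemma graph_dist_le_awalk: "awalk u p v \<Longrightarrow> graph_dist G u v \<le> ereal (real (length p))"
  unfolding graph_dist_def \<mu>_def
  by (rule INF_lower2[of p]) (auto simp: awalk_cost_one)

text \<open>The edge gives a walk from \<open>u\<close> over \<open>x\<close> and \<open>y\<close>
  to \<open>v\<close>, so the cap at 3 has no effect on the pairs between which mass is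
  moved.\<close>

lemma graph_dist_eq_near_dist:
  assumes "(x, y) \<in> parcs G" "u \<in> closed_neighbors G x" "v \<in> closed_neighbors G y"
  shows "graph_dist G u v = ereal (real (near_dist G u v))"
proof -
  have V: "x \<in> pverts G" "y \<in> pverts G" using assms(1) by (auto dest: in_arcsD1 in_arcsD2)
  have uV: "u \<in> pverts G" "v \<in> pverts G" using V assms closed_neighbors_subset by blast+
  have xy: "y \<in> neighbors G x" "x \<in> neighbors G y"
    using assms(1) arcs_symmetric by (auto simp: neighbors_def)
  have "\<exists>p. awalk u p v \<and> length p = near_dist G u v"
  proof -
    consider "u = v" | "u \<noteq> v" "v \<in> neighbors G u"
      | z where "u \<noteq> v" "v \<notin> neighbors G u" "z \<in> neighbors G u" "z \<in> neighbors G v"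
      | "u \<noteq> v" "v \<notin> neighbors G u" "neighbors G u \<inter> neighbors G v = {}" by blast
    then show ?thesis
    proof cases
      case 1
      then show ?thesis using uV by (intro exI[of _ "[]"]) (simp add: awalk_simps)
    next
      case 2
      then show ?thesis using uV
        by (intro exI[of _ "[(u, v)]"]) (auto simp: awalk_simps near_dist_def neighbors_def)
    next
      case 3
      then have "v \<in> neighbors G z" using neighbors_sym by blast
      then show ?thesis using 3 uV
        by (intro exI[of _ "[(u, z), (z, v)]"]) (auto simp: awalk_simps near_dist_def neighbors_def)
    next
      case 4
      \<comment> \<open>If \<open>u = x\<close>, then \<open>v\<close> is adjacent to
        \<open>u\<close> or shares the neighbour \<open>y\<close> with it; the case
        \<open>v = y\<close> is symmetric. Both are excluded here, so the walk over \<open>x\<close>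
        and \<open>y\<close> has exactly 3 arcs.\<close>
      have "u \<in> neighbors G x" "v \<in> neighbors G y"
        using 4 assms xy neighbors_sym by (auto simp: closed_neighbors_def)
      then have "x \<in> neighbors G u" "v \<in> neighbors G y" using neighbors_sym by blast+
      then show ?thesis using 4 uV xy
        by (intro exI[of _ "[(u, x), (x, y), (y, v)]"])
          (auto simp: awalk_simps near_dist_def neighbors_def)
    qed
  qed
  then show ?thesis
    using graph_dist_le_awalk near_dist_le_graph_dist by (metis antisym)
qed

end

section \<open>Transport along an edge of a regular graph\<close>

text \<open>The alternative \<open>c = 0\<close> serves the rows and columns of a plan in which the
  designated point may fail to be a vertex, such as \<open>\<phi> u\<close> for \<open>u\<close>
  outside the domain of the bijection.\<close>

lemma has_sum_single:
  fixes c :: "'b :: {comm_monoid_add, topological_space}"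
  assumes "a \<in> A \<or> c = 0"
  shows "((\<lambda>z. if z = a then c else 0) has_sum c) A"
proof (cases "a \<in> A")
  case True
  have "((\<lambda>z. if z = a then c else 0) has_sum c) {a}"
    by (rule has_sum_finiteI) auto
  then show ?thesis
    using True by (subst has_sum_cong_neutral[where T = "{a}"]) auto
next
  case False
  with assms have "c = 0" by simp
  then show ?thesis by (simp add: has_sum_0)
qed

locale regular_graph_edge = regular_graph G d
  for G :: "'a pair_pre_digraph" and d :: nat +
  fixes x y :: 'a
  assumes edge: "(x, y) \<in> parcs G"
begin

section \<open>The two ends of an edge and their measures\<close>

lemma verts: "x \<in> pverts G" "y \<in> pverts G"
  using edge by (auto dest: in_arcsD1 in_arcsD2)

lemma adjacent: "y \<in> neighbors G x" "x \<in> neighbors G y" "x \<noteq> y"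
  using edge arcs_symmetric neighbors_irrefl by (auto simp: neighbors_def)

lemma mem_closed_neighbors:
  "x \<in> closed_neighbors G x" "y \<in> closed_neighbors G x"
  "x \<in> closed_neighbors G y" "y \<in> closed_neighbors G y"
  using adjacent by (auto simp: closed_neighbors_def)

lemma finite_closed_neighbors: "u \<in> pverts G \<Longrightarrow> finite (closed_neighbors G u)"
  using locally_finite by (simp add: closed_neighbors_def)

lemma card_closed_neighbors: "u \<in> pverts G \<Longrightarrow> card (closed_neighbors G u) = d + 1"
  using locally_finite regular neighbors_irrefl by (simp add: closed_neighbors_def)

lemma degree_pos: "0 < d"
  using regular[OF verts(1)] locally_finite[OF verts(1)] adjacent card_gt_0_iff by blast

text \<open>Both ends of the edge lie in both closed neighbourhoods, so they drop out of the
  differences.\<close>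

lemma rest_eq_Diff:
  "rest G x y = closed_neighbors G x - closed_neighbors G y"
  "rest G y x = closed_neighbors G y - closed_neighbors G x"
  using adjacent neighbors_irrefl by (auto simp: rest_def triangles_def closed_neighbors_def)

lemma graph_dist_edge: "graph_dist G x y = 1"
  using graph_dist_eq_near_dist[OF edge mem_closed_neighbors(1,4)] adjacent
  by (simp add: near_dist_def one_ereal_def)

text \<open>This splits the measure into a uniform part on the closed neighbourhood, which a
  bijection can carry over, and an excess at \<open>u\<close>, which travels along the edge.\<close>

lemma walk_measure_eq:
  assumes "u \<in> {x, y}"
  shows "walk_measure G \<alpha> u v = (if v \<in> closed_neighbors G u then (1 - \<alpha>) / d else 0)
    + (if v = u then \<alpha> - (1 - \<alpha>) / d else 0)"
  using assms verts regular neighbors_irrefl by (auto simp: walk_measure_def closed_neighbors_def)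

text \<open>The uniform parts are matched by \<open>\<phi>\<close> and the excess goes from
  \<open>x\<close> to \<open>y\<close> at distance 1. The first condition on \<open>\<alpha>\<close>
  makes the excess nonnegative.\<close>

lemma wasserstein_le:
  assumes bij: "bij_betw \<phi> (closed_neighbors G x) (closed_neighbors G y)"
    and \<alpha>: "(1 - \<alpha>) / d \<le> \<alpha>" "\<alpha> \<le> 1"
  shows "wasserstein G (walk_measure G \<alpha> x) (walk_measure G \<alpha> y)
    \<le> ennreal ((1 - \<alpha>) / d * (\<Sum>u\<in>closed_neighbors G x. near_dist G u (\<phi> u))
        + (\<alpha> - (1 - \<alpha>) / d))"
proof -
  let ?V = "pverts G" and ?N = "closed_neighbors G x" and ?M = "closed_neighbors G y"
  define c where "c = (1 - \<alpha>) / d"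
  define e where "e = \<alpha> - c"
  have ce: "0 \<le> c" "0 \<le> e" "c + e \<le> 1"
    using \<alpha> by (simp_all add: c_def e_def)
  have sub: "?N \<subseteq> ?V" "?M \<subseteq> ?V" using verts closed_neighbors_subset by auto
  have fin: "finite ?N" "finite ?M" using verts finite_closed_neighbors by auto
  \<comment> \<open>The two contributions are added because \<open>\<phi> x\<close> may be
    \<open>y\<close>; that entry is then \<open>c + e = \<alpha>\<close>, still at most 1.\<close>
  define \<pi> where "\<pi> = (\<lambda>(u, v). (if u \<in> ?N \<and> v = \<phi> u then c else 0) + (if u = x \<and> v = y then e else 0))"
  define \<psi> where "\<psi> = inv_into ?N \<phi>"
  have \<phi>: "\<phi> u \<in> ?M" if "u \<in> ?N" for u using bij that by (auto simp: bij_betw_def)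
  \<comment> \<open>Written with the inverse bijection, the uniform part has at most one nonzero
    entry in each column, just as it has in each row.\<close>
  have \<psi>: "u \<in> ?N \<and> v = \<phi> u \<longleftrightarrow> v \<in> ?M \<and> u = \<psi> v" for u v
    unfolding \<psi>_def using bij \<phi>
    by (metis bij_betw_inv_into_left bij_betw_inv_into_right bij_betw_imp_surj_on inv_into_into)
  have row: "((\<lambda>v. \<pi> (u, v)) has_sum walk_measure G \<alpha> x u) ?V" for u
  proof -
    have "((\<lambda>v. (if v = \<phi> u then (if u \<in> ?N then c else 0) else 0)
        + (if v = y then (if u = x then e else 0) else 0)) has_sum
        ((if u \<in> ?N then c else 0) + (if u = x then e else 0))) ?V"
      using \<phi> sub verts by (intro has_sum_add has_sum_single) auto
    moreover have "walk_measure G \<alpha> x u = (if u \<in> ?N then c else 0) + (if u = x then e else 0)"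
      by (simp add: walk_measure_eq c_def e_def)
    moreover have "(\<lambda>v. \<pi> (u, v)) = (\<lambda>v. (if v = \<phi> u then (if u \<in> ?N then c else 0) else 0)
        + (if v = y then (if u = x then e else 0) else 0))"
      by (auto simp: \<pi>_def)
    ultimately show ?thesis by simp
  qed
  have column: "((\<lambda>u. \<pi> (u, v)) has_sum walk_measure G \<alpha> y v) ?V" for v
  proof -
    have "\<psi> v \<in> ?N" if "v \<in> ?M" for v using \<psi> that by blast
    then have "((\<lambda>u. (if u = \<psi> v then (if v \<in> ?M then c else 0) else 0)
        + (if u = x then (if v = y then e else 0) else 0)) has_sum
        ((if v \<in> ?M then c else 0) + (if v = y then e else 0))) ?V"
      using sub verts by (intro has_sum_add has_sum_single) auto
    moreover have "walk_measure G \<alpha> y v = (if v \<in> ?M then c else 0) + (if v = y then e else 0)"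
      by (simp add: walk_measure_eq c_def e_def)
    moreover have "(\<lambda>u. \<pi> (u, v)) = (\<lambda>u. (if u = \<psi> v then (if v \<in> ?M then c else 0) else 0)
        + (if u = x then (if v = y then e else 0) else 0))"
      unfolding \<pi>_def prod.case \<psi> by auto
    ultimately show ?thesis by simp
  qed
  have "\<pi> (u, v) \<in> {0..1}" for u v using ce by (auto simp: \<pi>_def)
  then have plan: "\<pi> \<in> transport_plans G (walk_measure G \<alpha> x) (walk_measure G \<alpha> y)"
    using row column by (simp add: transport_plans_def)
  \<comment> \<open>Outside \<open>?N \<times> ?M\<close> the plan vanishes, which cancels even
    infinite distances; inside, the distance is the truncated one.\<close>
  have "(\<Sum>\<^sub>\<infinity>(u, v)\<in>?V \<times> ?V. e2ennreal (graph_dist G u v) * ennreal (\<pi> (u, v)))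
      = (\<Sum>\<^sub>\<infinity>(u, v)\<in>?N \<times> ?M. ennreal (near_dist G u v * \<pi> (u, v)))"
  proof (rule infsum_cong_neutral)
    fix z assume "z \<in> ?V \<times> ?V - ?N \<times> ?M"
    then have "\<pi> z = 0"
      using \<phi> mem_closed_neighbors by (auto simp: \<pi>_def split: prod.splits)
    then show "(case z of (u, v) \<Rightarrow> e2ennreal (graph_dist G u v) * ennreal (\<pi> (u, v))) = 0"
      by (cases z) auto
  next
    fix z assume "z \<in> ?V \<times> ?V \<inter> ?N \<times> ?M"
    then obtain u v where z: "z = (u, v)" "u \<in> ?N" "v \<in> ?M" by auto
    then show "(case z of (u, v) \<Rightarrow> e2ennreal (graph_dist G u v) * ennreal (\<pi> (u, v)))
        = (case z of (u, v) \<Rightarrow> ennreal (near_dist G u v * \<pi> (u, v)))"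
      using graph_dist_eq_near_dist[OF edge z(2,3)] by (simp add: ennreal_mult' e2ennreal_ereal)
  qed (use sub in auto)
  also have "\<dots> = (\<Sum>z\<in>?N \<times> ?M. ennreal (case z of (u, v) \<Rightarrow> near_dist G u v * \<pi> (u, v)))"
    using fin by (simp add: case_prod_unfold)
  also have "\<dots> = ennreal (\<Sum>z\<in>?N \<times> ?M. case z of (u, v) \<Rightarrow> near_dist G u v * \<pi> (u, v))"
    using ce by (intro sum_ennreal) (auto simp: \<pi>_def)
  also have "(\<Sum>z\<in>?N \<times> ?M. case z of (u, v) \<Rightarrow> near_dist G u v * \<pi> (u, v))
      = (\<Sum>u\<in>?N. \<Sum>v\<in>?M. near_dist G u v * \<pi> (u, v))"
    by (simp add: sum.cartesian_product)
  also have "\<dots> = (\<Sum>u\<in>?N. c * near_dist G u (\<phi> u) + (if u = x then e else 0))"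
  proof (rule sum.cong[OF refl])
    fix u assume u: "u \<in> ?N"
    have "(\<Sum>v\<in>?M. near_dist G u v * \<pi> (u, v))
        = (\<Sum>v\<in>?M. (if v = \<phi> u then c * near_dist G u (\<phi> u) else 0)
            + (if v = y then (if u = x then e else 0) else 0))"
      by (rule sum.cong) (use u adjacent in \<open>auto simp: \<pi>_def near_dist_def algebra_simps\<close>)
    also have "\<dots> = c * near_dist G u (\<phi> u) + (if u = x then e else 0)"
      using \<phi>[OF u] mem_closed_neighbors fin by (simp add: sum.distrib)
    finally show "(\<Sum>v\<in>?M. near_dist G u v * \<pi> (u, v))
      = c * near_dist G u (\<phi> u) + (if u = x then e else 0)" .
  qed
  also have "\<dots> = c * (\<Sum>u\<in>?N. near_dist G u (\<phi> u)) + e"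
    using mem_closed_neighbors fin by (simp add: sum.distrib sum_distrib_left)
  finally show ?thesis
    using plan unfolding wasserstein_def c_def e_def by (intro INF_lower2[of \<pi>]) auto
qed

lemma sum_walk_measure:
  assumes "u \<in> {x, y}"
  shows "(\<Sum>v\<in>closed_neighbors G u. f v * walk_measure G \<alpha> u v)
    = (1 - \<alpha>) / d * (\<Sum>v\<in>closed_neighbors G u. f v) + (\<alpha> - (1 - \<alpha>) / d) * f u"
proof -
  have "finite (closed_neighbors G u)" "u \<in> closed_neighbors G u"
    using assms verts finite_closed_neighbors by (auto simp: closed_neighbors_def)
  moreover have "(\<Sum>v\<in>closed_neighbors G u. f v * walk_measure G \<alpha> u v)
    = (\<Sum>v\<in>closed_neighbors G u. (1 - \<alpha>) / d * f v + (if v = u then (\<alpha> - (1 - \<alpha>) / d) * f v else 0))"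
    by (rule sum.cong) (auto simp: walk_measure_eq[OF assms] algebra_simps)
  ultimately show ?thesis by (simp add: sum.distrib sum_distrib_left)
qed

text \<open>The easy half of Kantorovich duality: for every plan, the integral of
  \<open>f u - f v\<close> is at most the cost and depends only on the marginals.\<close>

lemma wasserstein_ge:
  assumes lip: "\<And>u v. f u - f v \<le> real (near_dist G u v)" and f: "f x - f y = 1"
  shows "ennreal ((1 - \<alpha>) / d * (sum f (closed_neighbors G x) - sum f (closed_neighbors G y))
        + (\<alpha> - (1 - \<alpha>) / d))
    \<le> wasserstein G (walk_measure G \<alpha> x) (walk_measure G \<alpha> y)"
  unfolding wasserstein_def
proof (rule INF_greatest)
  let ?V = "pverts G" and ?N = "closed_neighbors G x" and ?M = "closed_neighbors G y"
  fix \<pi> assume "\<pi> \<in> transport_plans G (walk_measure G \<alpha> x) (walk_measure G \<alpha> y)"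
  then have nonneg: "\<And>u v. u \<in> ?V \<Longrightarrow> v \<in> ?V \<Longrightarrow> 0 \<le> \<pi> (u, v)"
    and row: "\<And>u. u \<in> ?V \<Longrightarrow> ((\<lambda>v. \<pi> (u, v)) has_sum walk_measure G \<alpha> x u) ?V"
    and column: "\<And>v. v \<in> ?V \<Longrightarrow> ((\<lambda>u. \<pi> (u, v)) has_sum walk_measure G \<alpha> y v) ?V"
    by (auto simp: transport_plans_def)
  have sub: "?N \<subseteq> ?V" "?M \<subseteq> ?V" using verts closed_neighbors_subset by auto
  have fin: "finite ?N" "finite ?M" using verts finite_closed_neighbors by auto
  \<comment> \<open>Nonnegative entries with sum 0 all vanish. Hence every plan is supported on the
    finite set \<open>?N \<times> ?M\<close>, and its marginals are finite sums.\<close>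
  have zero: "\<pi> (u, v) = 0" if "u \<in> ?V" "v \<in> ?V" "u \<notin> ?N \<or> v \<notin> ?M" for u v
    using that(3)
  proof
    assume "u \<notin> ?N"
    then have "walk_measure G \<alpha> x u = 0"
      using mem_closed_neighbors by (auto simp: walk_measure_eq)
    then show ?thesis
      using nonneg_has_sum_le_0D[OF row[OF that(1)], of v] nonneg that by simp
  next
    assume "v \<notin> ?M"
    then have "walk_measure G \<alpha> y v = 0"
      using mem_closed_neighbors by (auto simp: walk_measure_eq)
    then show ?thesis
      using nonneg_has_sum_le_0D[OF column[OF that(2)], of u] nonneg that by simp
  qed
  have row_sum: "(\<Sum>v\<in>?M. \<pi> (u, v)) = walk_measure G \<alpha> x u" if "u \<in> ?N" for u
  proof -
    have "((\<lambda>v. \<pi> (u, v)) has_sum walk_measure G \<alpha> x u) ?M"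
      using row[of u] that sub zero by (subst has_sum_cong_neutral[where T = ?V]) auto
    then show ?thesis using fin has_sum_unique has_sum_finite by blast
  qed
  have column_sum: "(\<Sum>u\<in>?N. \<pi> (u, v)) = walk_measure G \<alpha> y v" if "v \<in> ?M" for v
  proof -
    have "((\<lambda>u. \<pi> (u, v)) has_sum walk_measure G \<alpha> y v) ?N"
      using column[of v] that sub zero by (subst has_sum_cong_neutral[where T = ?V]) auto
    then show ?thesis using fin has_sum_unique has_sum_finite by blast
  qed
  \<comment> \<open>The drop of 1 along the edge turns the excess into its share of the integrals of
    \<open>f\<close>.\<close>
  have "(1 - \<alpha>) / d * (sum f ?N - sum f ?M) + (\<alpha> - (1 - \<alpha>) / d)
      = (1 - \<alpha>) / d * (sum f ?N - sum f ?M) + (\<alpha> - (1 - \<alpha>) / d) * (f x - f y)"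
    using f by simp
  also have "\<dots> = (\<Sum>u\<in>?N. f u * walk_measure G \<alpha> x u) - (\<Sum>v\<in>?M. f v * walk_measure G \<alpha> y v)"
    by (simp add: sum_walk_measure right_diff_distrib)
  also have "\<dots> = (\<Sum>u\<in>?N. \<Sum>v\<in>?M. f u * \<pi> (u, v)) - (\<Sum>v\<in>?M. \<Sum>u\<in>?N. f v * \<pi> (u, v))"
    by (simp add: row_sum column_sum flip: sum_distrib_left)
  also have "\<dots> = (\<Sum>u\<in>?N. \<Sum>v\<in>?M. (f u - f v) * \<pi> (u, v))"
    by (subst sum.swap[of "\<lambda>v u. f v * \<pi> (u, v)"]) (simp add: sum_subtractf left_diff_distrib)
  also have "\<dots> \<le> (\<Sum>u\<in>?N. \<Sum>v\<in>?M. near_dist G u v * \<pi> (u, v))"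
    using sub nonneg lip by (intro sum_mono mult_right_mono) auto
  also have "\<dots> = (\<Sum>z\<in>?N \<times> ?M. case z of (u, v) \<Rightarrow> near_dist G u v * \<pi> (u, v))"
    by (simp add: sum.cartesian_product)
  finally have "ennreal ((1 - \<alpha>) / d * (sum f ?N - sum f ?M) + (\<alpha> - (1 - \<alpha>) / d))
      \<le> ennreal (\<Sum>z\<in>?N \<times> ?M. case z of (u, v) \<Rightarrow> near_dist G u v * \<pi> (u, v))"
    by (rule ennreal_leI)
  also have "\<dots> = (\<Sum>z\<in>?N \<times> ?M. ennreal (case z of (u, v) \<Rightarrow> near_dist G u v * \<pi> (u, v)))"
    using sub nonneg by (intro sum_ennreal[symmetric]) (auto intro!: mult_nonneg_nonneg)
  also have "\<dots> = (\<Sum>(u, v)\<in>?N \<times> ?M. e2ennreal (graph_dist G u v) * ennreal (\<pi> (u, v)))"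
  proof (rule sum.cong[OF refl])
    fix z assume "z \<in> ?N \<times> ?M"
    then obtain u v where z: "z = (u, v)" "u \<in> ?N" "v \<in> ?M" by auto
    then show "ennreal (case z of (u, v) \<Rightarrow> near_dist G u v * \<pi> (u, v))
      = (case z of (u, v) \<Rightarrow> e2ennreal (graph_dist G u v) * ennreal (\<pi> (u, v)))"
      using graph_dist_eq_near_dist[OF edge z(2,3)] by (simp add: ennreal_mult' e2ennreal_ereal)
  qed
  also have "\<dots> \<le> (\<Sum>\<^sub>\<infinity>(u, v)\<in>?V \<times> ?V. e2ennreal (graph_dist G u v) * ennreal (\<pi> (u, v)))"
    using sub fin by (subst nonneg_infsum_complete) (auto intro!: SUP_upper)
  finally show "ennreal ((1 - \<alpha>) / d * (sum f ?N - sum f ?M) + (\<alpha> - (1 - \<alpha>) / d))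
      \<le> (\<Sum>\<^sub>\<infinity>(u, v)\<in>?V \<times> ?V. e2ennreal (graph_dist G u v) * ennreal (\<pi> (u, v)))" .
qed

text \<open>The potential certifies that \<open>\<phi>\<close> is optimal: the upper and lower
  bounds agree for \<open>\<alpha>\<close> near 1, where the quotient is therefore constant.\<close>

lemma LLY_curvature_eq:
  assumes bij: "bij_betw \<phi> (closed_neighbors G x) (closed_neighbors G y)"
    and lip: "\<And>u v. f u - f v \<le> real (near_dist G u v)" and f: "f x - f y = 1"
    and cost: "sum f (closed_neighbors G x) - sum f (closed_neighbors G y)
      = (\<Sum>u\<in>closed_neighbors G x. near_dist G u (\<phi> u))"
  shows "LLY_curvature G x y
    = (real d + 1 - real (\<Sum>u\<in>closed_neighbors G x. near_dist G u (\<phi> u))) / d"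
proof -
  define A where "A = (\<Sum>u\<in>closed_neighbors G x. near_dist G u (\<phi> u))"
  \<comment> \<open>Above 1/2, \<open>(1 - \<alpha>) / d \<le> 1 - \<alpha> \<le> \<alpha>\<close>,
    so the excess is nonnegative for every degree.\<close>
  have "eventually (\<lambda>\<alpha>. \<alpha> \<in> {1/2<..<1}) (at_left (1::real))"
    by (rule eventually_at_leftI[of "1/2"]) auto
  then have "eventually (\<lambda>\<alpha>. alpha_curvature G \<alpha> x y / (1 - \<alpha>) = (real d + 1 - A) / d) (at_left 1)"
  proof eventually_elim
    case (elim \<alpha>)
    have d: "real d \<ge> 1" using degree_pos by simp
    have "1 - \<alpha> \<le> \<alpha>" using elim by simp
    moreover have "(1 - \<alpha>) / d \<le> 1 - \<alpha>"
      using mult_left_mono[OF d, of "1 - \<alpha>"] elim degree_pos by (simp add: divide_le_eq)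
    ultimately have e: "(1 - \<alpha>) / d \<le> \<alpha>" by linarith
    have "wasserstein G (walk_measure G \<alpha> x) (walk_measure G \<alpha> y)
      = ennreal ((1 - \<alpha>) / d * A + (\<alpha> - (1 - \<alpha>) / d))"
      using wasserstein_le[OF bij e] wasserstein_ge[OF lip f, of \<alpha>] elim
      unfolding cost A_def[symmetric] by (intro antisym) auto
    moreover have "0 \<le> (1 - \<alpha>) / d * A + (\<alpha> - (1 - \<alpha>) / d)"
      using e elim d by (intro add_nonneg_nonneg mult_nonneg_nonneg) auto
    ultimately have "alpha_curvature G \<alpha> x y = 1 - ((1 - \<alpha>) / d * A + (\<alpha> - (1 - \<alpha>) / d))"
      by (simp add: alpha_curvature_def graph_dist_edge)
    also have "\<dots> = (1 - \<alpha>) * ((real d + 1 - A) / d)"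
      using d by (simp add: field_simps)
    finally show ?case using elim by simp
  qed
  then have "((\<lambda>\<alpha>. alpha_curvature G \<alpha> x y / (1 - \<alpha>)) \<longlongrightarrow> (real d + 1 - A) / d) (at_left 1)"
    by (rule tendsto_eventually)
  then show ?thesis
    unfolding LLY_curvature_def A_def by (intro tendsto_Lim) auto
qed

section \<open>Optimal bijections and their potentials\<close>

lemma card_rest: "card (rest G x y) = card (rest G y x)"
  using card_Diff_subset_Int[of "closed_neighbors G x" "closed_neighbors G y"]
    card_Diff_subset_Int[of "closed_neighbors G y" "closed_neighbors G x"]
  unfolding rest_eq_Diff
  by (simp add: Int_commute verts finite_closed_neighbors card_closed_neighbors)

text \<open>Adding the pair \<open>(x, y)\<close> to an optimal assignment of \<open>rest G x y\<close> to \<open>rest G y x\<close> keeps it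
  optimal: if another assignment sends \<open>x\<close> to \<open>v\<close> and \<open>u\<close> to \<open>y\<close>, these two pairs cost \<open>2 + 2\<close>,
  while \<open>(x, y)\<close> and \<open>(u, v)\<close> together cost at most \<open>1 + 3\<close>. This is what makes the dual
  potential drop by exactly 1 from \<open>x\<close> to \<open>y\<close>.\<close>

lemma optimal_assignment_insert:
  assumes \<psi>: "bij_betw \<psi> (rest G x y) (rest G y x)"
    and opt: "\<And>\<psi>'. bij_betw \<psi>' (rest G x y) (rest G y x) \<Longrightarrow>
      (\<Sum>u\<in>rest G x y. near_dist G u (\<psi> u)) \<le> (\<Sum>u\<in>rest G x y. near_dist G u (\<psi>' u))"
    and \<tau>: "bij_betw \<tau> (insert x (rest G x y)) (insert y (rest G y x))"
  shows "(\<Sum>u\<in>rest G x y. near_dist G u (\<psi> u)) + 1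
    \<le> (\<Sum>u\<in>insert x (rest G x y). near_dist G u (\<tau> u))"
proof -
  let ?R = "rest G x y" and ?S = "rest G y x"
  have fin: "finite ?R" using rest_eq_Diff verts finite_closed_neighbors by simp
  have x: "x \<notin> ?R" "x \<notin> ?S" and y: "y \<notin> ?S" "y \<notin> ?R"
    using mem_closed_neighbors rest_eq_Diff by auto
  have xy: "near_dist G x y = 1" using adjacent by (simp add: near_dist_def)
  have inj: "inj_on \<tau> (insert x ?R)" and img: "\<tau> ` insert x ?R = insert y ?S"
    using \<tau> by (auto simp: bij_betw_def)
  show ?thesis
  proof (cases "\<tau> x = y")
    case True
    have "bij_betw \<tau> ?R ?S"
      using notIn_Un_bij_betw3[of x ?R \<tau> ?S] \<tau> x y True by simp
    then show ?thesis using opt[of \<tau>] fin x True xy by simp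
  next
    case False
    have "y \<in> \<tau> ` insert x ?R" unfolding img by simp
    then obtain u where u: "u \<in> ?R" "\<tau> u = y" using False by auto
    define v where "v = \<tau> x"
    have v: "v \<in> ?S" using img False by (auto simp: v_def)
    \<comment> \<open>The detour is undone: \<open>u\<close> takes over the target of
      \<open>x\<close>, which leaves \<open>x\<close> free for \<open>y\<close>.\<close>
    define \<psi>' where "\<psi>' = \<tau>(u := v)"
    have "\<psi>' ` ?R = \<tau> ` (insert x ?R - {u})"
      using u x by (auto simp: \<psi>'_def v_def)
    also have "\<dots> = ?S"
      using inj_on_image_set_diff[OF inj, of "insert x ?R" "{u}"] u img y by auto
    finally have "\<psi>' ` ?R = ?S" .
    then have "bij_betw \<psi>' ?R ?S"
      using fin card_rest by (simp add: bij_betw_def eq_card_imp_inj_on)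
    from opt[OF this] have "(\<Sum>u\<in>?R. near_dist G u (\<psi> u)) \<le> (\<Sum>u\<in>?R. near_dist G u (\<psi>' u))" .
    also have "\<dots> = near_dist G u v + (\<Sum>z\<in>?R - {u}. near_dist G z (\<tau> z))"
      using fin u by (simp add: sum.remove \<psi>'_def)
    also have "near_dist G u v \<le> 3" by (rule near_dist_le_3)
    finally have "(\<Sum>u\<in>?R. near_dist G u (\<psi> u)) + 1 \<le> 4 + (\<Sum>z\<in>?R - {u}. near_dist G z (\<tau> z))"
      by simp
    \<comment> \<open>By the choice of the two remainder sets, \<open>v\<close> lies outside the
      closed neighbourhood of \<open>x\<close>, and \<open>u\<close> outside that of
      \<open>y\<close>.\<close>
    moreover have "2 \<le> near_dist G x v"
      using v near_dist_le_1_iff[of G x v] rest_eq_Diff by force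
    moreover have "2 \<le> near_dist G u y"
      using u near_dist_le_1_iff[of G u y] rest_eq_Diff closed_neighbors_sym by force
    moreover have "(\<Sum>z\<in>insert x ?R. near_dist G z (\<tau> z))
        = near_dist G x v + near_dist G u y + (\<Sum>z\<in>?R - {u}. near_dist G z (\<tau> z))"
      using fin u x by (simp add: sum.remove v_def)
    ultimately show ?thesis by simp
  qed
qed

text \<open>A cheapest bijection of the remainders exists because costs are natural numbers. The
  pair \<open>(x, y)\<close> is added only to obtain the potential; the bijection
  \<open>\<phi>\<close> itself fixes \<open>x\<close> and \<open>y\<close>, being common
  points.\<close>

lemma exists_optimal_transport:
  obtains \<phi> f where
    "bij_betw \<phi> (closed_neighbors G x) (closed_neighbors G y)"
    "\<And>u. u \<in> closed_neighbors G x \<inter> closed_neighbors G y \<Longrightarrow> \<phi> u = u"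
    "\<And>u. u \<in> rest G x y \<Longrightarrow> \<phi> u \<in> rest G y x"
    "\<And>u v. f u - f v \<le> real (near_dist G u v)" "f x - f y = 1"
    "sum f (closed_neighbors G x) - sum f (closed_neighbors G y)
      = (\<Sum>u\<in>closed_neighbors G x. near_dist G u (\<phi> u))"
proof -
  let ?R = "rest G x y" and ?S = "rest G y x"
  let ?N = "closed_neighbors G x" and ?M = "closed_neighbors G y"
  have fin: "finite ?N" "finite ?M" using verts finite_closed_neighbors by auto
  have finR: "finite ?R" "finite ?S" using fin rest_eq_Diff by auto
  have x: "x \<notin> ?R" and y: "y \<notin> ?S" using mem_closed_neighbors rest_eq_Diff by auto
  have xy: "near_dist G x y = 1" using adjacent by (simp add: near_dist_def)
  obtain \<psi>0 where "bij_betw \<psi>0 ?R ?S"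
    using finite_same_card_bij[OF finR card_rest] by blast
  then obtain \<psi> where \<psi>: "bij_betw \<psi> ?R ?S"
    and opt: "\<And>\<psi>'. bij_betw \<psi>' ?R ?S \<Longrightarrow>
      (\<Sum>u\<in>?R. near_dist G u (\<psi> u)) \<le> (\<Sum>u\<in>?R. near_dist G u (\<psi>' u))"
    using ex_has_least_nat[of "\<lambda>\<psi>. bij_betw \<psi> ?R ?S" \<psi>0 "\<lambda>\<psi>. \<Sum>u\<in>?R. near_dist G u (\<psi> u)"]
    by auto
  define \<sigma> where "\<sigma> = \<psi>(x := y)"
  have "bij_betw \<sigma> ?R ?S"
    using \<psi> x by (subst bij_betw_cong[where g = \<psi>]) (auto simp: \<sigma>_def)
  then have \<sigma>: "bij_betw \<sigma> (insert x ?R) (insert y ?S)"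
    using notIn_Un_bij_betw[of x ?R \<sigma> ?S] x y by (simp add: \<sigma>_def)
  have \<sigma>_sum: "(\<Sum>u\<in>insert x ?R. near_dist G u (\<sigma> u)) = (\<Sum>u\<in>?R. near_dist G u (\<psi> u)) + 1"
  proof -
    have "(\<Sum>u\<in>?R. near_dist G u (\<sigma> u)) = (\<Sum>u\<in>?R. near_dist G u (\<psi> u))"
      by (rule sum.cong) (use x in \<open>auto simp: \<sigma>_def\<close>)
    then show ?thesis using finR x xy by (simp add: \<sigma>_def)
  qed
  have "\<exists>f. (\<forall>u v. f u - f v \<le> real (near_dist G u v)) \<and>
    (\<forall>u\<in>insert x ?R. f u - f (\<sigma> u) = real (near_dist G u (\<sigma> u)))"
  proof (rule exists_dual_potential)
    fix \<tau> assume "\<tau> permutes insert x ?R"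
    then have "bij_betw (\<sigma> \<circ> \<tau>) (insert x ?R) (insert y ?S)"
      using \<sigma> by (metis bij_betw_trans permutes_imp_bij)
    from optimal_assignment_insert[OF \<psi> opt this]
    have "(\<Sum>u\<in>insert x ?R. near_dist G u (\<sigma> u)) \<le> (\<Sum>u\<in>insert x ?R. near_dist G u (\<sigma> (\<tau> u)))"
      unfolding \<sigma>_sum by simp
    then show "(\<Sum>u\<in>insert x ?R. real (near_dist G u (\<sigma> u)))
        \<le> (\<Sum>u\<in>insert x ?R. real (near_dist G u (\<sigma> (\<tau> u))))"
      by (simp only: of_nat_sum[symmetric] of_nat_le_iff)
  next
    show "real (near_dist G u v) = real (near_dist G v u)" for u v
      using near_dist_sym by simp
    show "real (near_dist G u z) \<le> real (near_dist G u v) + real (near_dist G v z)" for u v z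
      using near_dist_triangle[of u z v] by simp
  qed (use finR in auto)
  then obtain f where f: "\<And>u v. f u - f v \<le> real (near_dist G u v)"
    "\<And>u. u \<in> insert x ?R \<Longrightarrow> f u - f (\<sigma> u) = real (near_dist G u (\<sigma> u))" by blast
  define \<phi> where "\<phi> u = (if u \<in> ?R then \<psi> u else u)" for u
  have id: "bij_betw \<phi> (?N \<inter> ?M) (?N \<inter> ?M)"
    using bij_betw_cong[of "?N \<inter> ?M" \<phi> id] rest_eq_Diff by (auto simp: \<phi>_def)
  have "bij_betw \<phi> ?R ?S"
    using \<psi> bij_betw_cong[of ?R \<phi> \<psi>] by (auto simp: \<phi>_def)
  moreover have "?N \<inter> ?M \<union> ?R = ?N" "?N \<inter> ?M \<union> ?S = ?M" "?N \<inter> ?M \<inter> ?S = {}"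
    unfolding rest_eq_Diff by blast+
  ultimately have bij: "bij_betw \<phi> ?N ?M" using bij_betw_combine[OF id] by metis
  have pair: "f u - f (\<phi> u) = real (near_dist G u (\<phi> u))" for u
    using f(2)[of u] x by (auto simp: \<phi>_def \<sigma>_def split: if_splits)
  have "sum f ?N - sum f ?M = (\<Sum>u\<in>?N. f u - f (\<phi> u))"
    using sum.reindex_bij_betw[OF bij, of f] by (simp add: sum_subtractf)
  also have "\<dots> = (\<Sum>u\<in>?N. near_dist G u (\<phi> u))" by (simp add: pair)
  finally have "sum f ?N - sum f ?M = (\<Sum>u\<in>?N. near_dist G u (\<phi> u))" .
  moreover have "f x - f y = 1" using f(2)[of x] xy by (simp add: \<sigma>_def)
  moreover have "\<phi> u \<in> ?S" if "u \<in> ?R" for u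
    using that \<psi> by (auto simp: \<phi>_def bij_betw_def)
  moreover have "\<phi> u = u" if "u \<in> ?N \<inter> ?M" for u
    using that rest_eq_Diff by (auto simp: \<phi>_def)
  ultimately show ?thesis using that[of \<phi> f] bij f(1) by blast
qed

text \<open>Tested against the dual potential, no bijection is cheaper than the optimal one. In the
  product it therefore suffices to exhibit some bijection.\<close>

lemma LLY_curvature_ge:
  assumes bij: "bij_betw \<phi> (closed_neighbors G x) (closed_neighbors G y)"
  shows "LLY_curvature G x y
    \<ge> (real d + 1 - real (\<Sum>u\<in>closed_neighbors G x. near_dist G u (\<phi> u))) / d"
proof -
  obtain \<phi>' f where \<phi>': "bij_betw \<phi>' (closed_neighbors G x) (closed_neighbors G y)"
    and "\<And>u. u \<in> closed_neighbors G x \<inter> closed_neighbors G y \<Longrightarrow> \<phi>' u = u"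
    and "\<And>u. u \<in> rest G x y \<Longrightarrow> \<phi>' u \<in> rest G y x"
    and lip: "\<And>u v. f u - f v \<le> real (near_dist G u v)" and f: "f x - f y = 1"
    and cost: "sum f (closed_neighbors G x) - sum f (closed_neighbors G y)
      = (\<Sum>u\<in>closed_neighbors G x. near_dist G u (\<phi>' u))"
    using exists_optimal_transport by blast
  have "sum f (closed_neighbors G x) - sum f (closed_neighbors G y)
      = (\<Sum>u\<in>closed_neighbors G x. f u - f (\<phi> u))"
    using sum.reindex_bij_betw[OF bij, of f] by (simp add: sum_subtractf)
  also have "\<dots> \<le> (\<Sum>u\<in>closed_neighbors G x. real (near_dist G u (\<phi> u)))"
    by (rule sum_mono) (rule lip)
  finally show ?thesis
    unfolding LLY_curvature_eq[OF \<phi>' lip f cost] cost by (intro divide_right_mono) auto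
qed

end

section \<open>The strong product\<close>

lemma strong_product_neighbors:
  assumes "a \<in> pverts G" "b \<in> pverts H"
  shows "neighbors (strong_product G H) (a, b)
    = closed_neighbors G a \<times> closed_neighbors H b - {(a, b)}"
  using assms by (auto simp: neighbors_def strong_product_def)

text \<open>This product form is why adjacency and distance 2 are expressed through closed
  neighbourhoods.\<close>

lemma strong_product_closed_neighbors:
  assumes "a \<in> pverts G" "b \<in> pverts H"
  shows "closed_neighbors (strong_product G H) (a, b) = closed_neighbors G a \<times> closed_neighbors H b"
  unfolding closed_neighbors_def[of "strong_product G H"] strong_product_neighbors[OF assms]
  by (auto simp: closed_neighbors_def)

section \<open>Regularity of the product and distances in it\<close>

lemma bidirected_strong_product:
  assumes "pair_bidirected_digraph G" "pair_bidirected_digraph H"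
  shows "pair_bidirected_digraph (strong_product G H)"
proof -
  interpret G: pair_bidirected_digraph G by fact
  interpret H: pair_bidirected_digraph H by fact
  show ?thesis
  proof
    show "symmetric (with_proj (strong_product G H))"
      unfolding symmetric_def with_proj_simps
    proof (rule symI)
      fix p q assume "(p, q) \<in> parcs (strong_product G H)"
      then obtain a b a' b' where pq: "p = (a, b)" "q = (a', b')" "a \<in> pverts G" "b \<in> pverts H"
          "p \<noteq> q" "a' \<in> closed_neighbors G a" "b' \<in> closed_neighbors H b"
        by (auto simp: strong_product_def)
      moreover have "a' \<in> pverts G" "b' \<in> pverts H"
        using pq G.closed_neighbors_subset H.closed_neighbors_subset by blast+
      moreover have "a \<in> closed_neighbors G a'" "b \<in> closed_neighbors H b'"
        using pq G.closed_neighbors_sym H.closed_neighbors_sym by blast+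
      ultimately show "(q, p) \<in> parcs (strong_product G H)"
        by (auto simp: strong_product_def)
    qed
  qed (use G.closed_neighbors_subset[THEN subsetD] H.closed_neighbors_subset[THEN subsetD]
    in \<open>auto simp: strong_product_def\<close>)
qed

lemma regular_strong_product:
  assumes "regular_graph G d" "regular_graph H e"
  shows "regular_graph (strong_product G H) (d + e + d * e)"
proof -
  interpret G: regular_graph G d by fact
  interpret H: regular_graph H e by fact
  interpret GH: pair_bidirected_digraph "strong_product G H"
    by (rule bidirected_strong_product) unfold_locales
  have closed: "finite (closed_neighbors G a)" "card (closed_neighbors G a) = d + 1"
    if "a \<in> pverts G" for a
    using that G.locally_finite G.regular G.neighbors_irrefl by (simp_all add: closed_neighbors_def)
  have closed': "finite (closed_neighbors H b)" "card (closed_neighbors H b) = e + 1"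
    if "b \<in> pverts H" for b
    using that H.locally_finite H.regular H.neighbors_irrefl by (simp_all add: closed_neighbors_def)
  show ?thesis
  proof
    fix z assume "z \<in> pverts (strong_product G H)"
    then obtain a b where z: "z = (a, b)" "a \<in> pverts G" "b \<in> pverts H"
      by (auto simp: strong_product_def)
    then show "finite (neighbors (strong_product G H) z)"
      by (simp add: strong_product_neighbors closed closed')
    have "(a, b) \<in> closed_neighbors G a \<times> closed_neighbors H b" by (simp add: closed_neighbors_def)
    then show "card (neighbors (strong_product G H) z) = d + e + d * e"
      using z by (simp add: strong_product_neighbors closed closed' card_cartesian_product)
  qed
qed

text \<open>The bounds by 1 and by 2 are conditions on closed neighbourhoods and hold in the product
  once they hold in both factors. Beyond 2 the cap at 3 suffices.\<close>

lemma near_dist_strong_product_le: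
  assumes "pair_bidirected_digraph G" "pair_bidirected_digraph H"
    and "a \<in> pverts G" "a' \<in> pverts G" "b \<in> pverts H" "b' \<in> pverts H"
  shows "near_dist (strong_product G H) (a, b) (a', b') \<le> max (near_dist G a a') (near_dist H b b')"
proof -
  interpret G: pair_bidirected_digraph G by fact
  interpret H: pair_bidirected_digraph H by fact
  interpret GH: pair_bidirected_digraph "strong_product G H"
    by (rule bidirected_strong_product) unfold_locales
  let ?m = "max (near_dist G a a') (near_dist H b b')"
  note closed = strong_product_closed_neighbors[OF assms(3,5)] strong_product_closed_neighbors[OF assms(4,6)]
  have zero: "a = a' \<and> b = b'" if "?m = 0"
    using that near_dist_pos[of a a' G] near_dist_pos[of b b' H] by force
  have one: "near_dist (strong_product G H) (a, b) (a', b') \<le> 1" if "?m \<le> 1"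
    using that unfolding near_dist_le_1_iff max.bounded_iff closed by auto
  have two: "near_dist (strong_product G H) (a, b) (a', b') \<le> 2" if "?m \<le> 2"
    using that
    unfolding G.near_dist_le_2_iff H.near_dist_le_2_iff GH.near_dist_le_2_iff max.bounded_iff closed
    by auto
  consider "?m = 0" | "?m = 1" | "?m = 2" | "?m \<ge> 3" by linarith
  then show ?thesis
    using zero one two near_dist_le_3[of "strong_product G H" "(a, b)" "(a', b')"]
    by cases (auto simp del: max.bounded_iff)
qed

theorem theorem3:
  fixes G :: "'a pair_pre_digraph" and H :: "'b pair_pre_digraph"
    and d\<^sub>G d\<^sub>H :: nat and x\<^sub>1 x\<^sub>2 :: 'a and y\<^sub>1 y\<^sub>2 :: 'b
  assumes "regular_graph G d\<^sub>G" and "regular_graph H d\<^sub>H"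
    and "(x\<^sub>1, x\<^sub>2) \<in> parcs G" and "(y\<^sub>1, y\<^sub>2) \<in> parcs H"
    and "closed_neighbors G x\<^sub>1 \<noteq> closed_neighbors G x\<^sub>2"
    and "closed_neighbors H y\<^sub>1 \<noteq> closed_neighbors H y\<^sub>2"
  shows
    "let d = real (d\<^sub>G + d\<^sub>H + d\<^sub>G * d\<^sub>H);
         X = 1 - (real (card (rest G x\<^sub>1 x\<^sub>2)) * real (card (rest H y\<^sub>1 y\<^sub>2)) - 1) / d
     in LLY_curvature (strong_product G H) (x\<^sub>1, y\<^sub>1) (x\<^sub>2, y\<^sub>2)
        \<ge> real (d\<^sub>H * (d\<^sub>G + 1)) / d * LLY_curvature H y\<^sub>1 y\<^sub>2
          + real (d\<^sub>G * (d\<^sub>H + 1)) / d * LLY_curvature G x\<^sub>1 x\<^sub>2 - X"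
proof -
  interpret G: regular_graph_edge G d\<^sub>G x\<^sub>1 x\<^sub>2
    using assms by (simp add: regular_graph_edge_def regular_graph_edge_axioms_def)
  interpret H: regular_graph_edge H d\<^sub>H y\<^sub>1 y\<^sub>2
    using assms by (simp add: regular_graph_edge_def regular_graph_edge_axioms_def)
  define D where "D = d\<^sub>G + d\<^sub>H + d\<^sub>G * d\<^sub>H"
  let ?P = "strong_product G H"
  have "((x\<^sub>1, y\<^sub>1), (x\<^sub>2, y\<^sub>2)) \<in> parcs ?P"
    using G.verts H.verts G.adjacent G.mem_closed_neighbors H.mem_closed_neighbors
    by (simp add: strong_product_def)
  then interpret P: regular_graph_edge ?P D "(x\<^sub>1, y\<^sub>1)" "(x\<^sub>2, y\<^sub>2)"
    using regular_strong_product[OF assms(1,2)]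
    by (simp add: regular_graph_edge_def regular_graph_edge_axioms_def D_def)
  let ?N = "closed_neighbors G x\<^sub>1" and ?M = "closed_neighbors H y\<^sub>1"
  let ?R = "rest G x\<^sub>1 x\<^sub>2" and ?S = "rest H y\<^sub>1 y\<^sub>2"
  obtain \<phi> f where \<phi>: "bij_betw \<phi> ?N (closed_neighbors G x\<^sub>2)"
      "\<And>u. u \<in> ?N \<inter> closed_neighbors G x\<^sub>2 \<Longrightarrow> \<phi> u = u"
      "\<And>u. u \<in> ?R \<Longrightarrow> \<phi> u \<in> rest G x\<^sub>2 x\<^sub>1"
    and f: "\<And>u v. f u - f v \<le> real (near_dist G u v)" "f x\<^sub>1 - f x\<^sub>2 = 1"
      "sum f ?N - sum f (closed_neighbors G x\<^sub>2) = (\<Sum>u\<in>?N. near_dist G u (\<phi> u))"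
    using G.exists_optimal_transport by blast
  obtain \<psi> g where \<psi>: "bij_betw \<psi> ?M (closed_neighbors H y\<^sub>2)"
      "\<And>v. v \<in> ?M \<inter> closed_neighbors H y\<^sub>2 \<Longrightarrow> \<psi> v = v"
      "\<And>v. v \<in> ?S \<Longrightarrow> \<psi> v \<in> rest H y\<^sub>2 y\<^sub>1"
    and g: "\<And>u v. g u - g v \<le> real (near_dist H u v)" "g y\<^sub>1 - g y\<^sub>2 = 1"
      "sum g ?M - sum g (closed_neighbors H y\<^sub>2) = (\<Sum>v\<in>?M. near_dist H v (\<psi> v))"
    using H.exists_optimal_transport by blast
  define A B where "A = real (\<Sum>u\<in>?N. near_dist G u (\<phi> u))"
    and "B = real (\<Sum>v\<in>?M. near_dist H v (\<psi> v))"
  define p q where "p = real (card ?R)" and "q = real (card ?S)"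
  have LG: "LLY_curvature G x\<^sub>1 x\<^sub>2 = (real d\<^sub>G + 1 - A) / d\<^sub>G"
    unfolding A_def by (rule G.LLY_curvature_eq[OF \<phi>(1) f])
  have LH: "LLY_curvature H y\<^sub>1 y\<^sub>2 = (real d\<^sub>H + 1 - B) / d\<^sub>H"
    unfolding B_def by (rule H.LLY_curvature_eq[OF \<psi>(1) g])
  have fin: "finite ?N" "finite ?M"
    using G.verts H.verts G.finite_closed_neighbors H.finite_closed_neighbors by auto
  have card: "card ?N = d\<^sub>G + 1" "card ?M = d\<^sub>H + 1"
    using G.verts H.verts G.card_closed_neighbors H.card_closed_neighbors by auto
  have closed: "closed_neighbors ?P (x\<^sub>1, y\<^sub>1) = ?N \<times> ?M"
    "closed_neighbors ?P (x\<^sub>2, y\<^sub>2) = closed_neighbors G x\<^sub>2 \<times> closed_neighbors H y\<^sub>2"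
    using G.verts H.verts by (simp_all add: strong_product_closed_neighbors)
  define C where
    "C = real (\<Sum>z\<in>closed_neighbors ?P (x\<^sub>1, y\<^sub>1). near_dist ?P z (map_prod \<phi> \<psi> z))"
  have "bij_betw (map_prod \<phi> \<psi>) (?N \<times> ?M) (closed_neighbors G x\<^sub>2 \<times> closed_neighbors H y\<^sub>2)"
    using \<phi>(1) \<psi>(1) by (rule bij_betw_map_prod)
  then have LP: "LLY_curvature ?P (x\<^sub>1, y\<^sub>1) (x\<^sub>2, y\<^sub>2) \<ge> (real D + 1 - C) / D"
    unfolding C_def by (intro P.LLY_curvature_ge) (simp add: closed)
  \<comment> \<open>Indicators of the two remainder sets: the saving \<open>r u * s v\<close> is 1
    exactly where both coordinates move, and it sums to \<open>p * q\<close>.\<close>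
  define r s where "r u = (if u \<in> ?R then 1 else (0 :: real))"
    and "s v = (if v \<in> ?S then 1 else (0 :: real))" for u v
  have bidirected: "pair_bidirected_digraph G" "pair_bidirected_digraph H" by unfold_locales
  have point: "real (near_dist ?P (u, v) (\<phi> u, \<psi> v))
      \<le> real (near_dist G u (\<phi> u)) + real (near_dist H v (\<psi> v)) - r u * s v"
    if uv: "u \<in> ?N" "v \<in> ?M" for u v
  proof -
    have "\<phi> u \<in> closed_neighbors G x\<^sub>2" "\<psi> v \<in> closed_neighbors H y\<^sub>2"
      using uv \<phi>(1) \<psi>(1) by (auto simp: bij_betw_def)
    then have V: "u \<in> pverts G" "\<phi> u \<in> pverts G" "v \<in> pverts H" "\<psi> v \<in> pverts H"
      using uv G.closed_neighbors_subset H.closed_neighbors_subset G.verts H.verts by blast+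
    have le: "near_dist ?P (u, v) (\<phi> u, \<psi> v) \<le> max (near_dist G u (\<phi> u)) (near_dist H v (\<psi> v))"
      by (rule near_dist_strong_product_le[OF bidirected V])
    show ?thesis
    proof (cases "u \<in> ?R \<and> v \<in> ?S")
      case True
      \<comment> \<open>Each remainder set is sent to the opposite one, which is disjoint from it.
        Both distances are thus at least 1, so their maximum is at most their sum minus 1.\<close>
      then have "u \<noteq> \<phi> u" "v \<noteq> \<psi> v"
        using \<phi>(3)[of u] \<psi>(3)[of v] G.rest_eq_Diff H.rest_eq_Diff by auto
      then have "1 \<le> near_dist G u (\<phi> u)" "1 \<le> near_dist H v (\<psi> v)"
        by (metis near_dist_pos)+
      then have "near_dist ?P (u, v) (\<phi> u, \<psi> v) + 1 \<le> near_dist G u (\<phi> u) + near_dist H v (\<psi> v)"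
        using le by linarith
      then show ?thesis using True by (simp add: r_def s_def)
    next
      case False
      have "near_dist ?P (u, v) (\<phi> u, \<psi> v) \<le> near_dist G u (\<phi> u) + near_dist H v (\<psi> v)"
        using le by linarith
      then show ?thesis using False by (auto simp: r_def s_def)
    qed
  qed
  have pq: "sum r ?N = p" "sum s ?M = q"
  proof -
    have "?N \<inter> ?R = ?R" "?M \<inter> ?S = ?S" using G.rest_eq_Diff H.rest_eq_Diff by auto
    then show "sum r ?N = p" "sum s ?M = q"
      using fin by (simp_all add: r_def s_def p_def q_def flip: sum.inter_restrict)
  qed
  have "C = (\<Sum>u\<in>?N. \<Sum>v\<in>?M. real (near_dist ?P (u, v) (\<phi> u, \<psi> v)))"
    unfolding C_def closed of_nat_sum sum.cartesian_product by (rule sum.cong) auto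
  also have "\<dots> \<le> (\<Sum>u\<in>?N. \<Sum>v\<in>?M.
      real (near_dist G u (\<phi> u)) + real (near_dist H v (\<psi> v)) - r u * s v)"
    by (intro sum_mono point)
  also have "\<dots> = (\<Sum>u\<in>?N. (real d\<^sub>H + 1) * real (near_dist G u (\<phi> u)) + B - r u * q)"
    by (simp add: sum.distrib sum_subtractf card B_def pq flip: sum_distrib_left)
  also have "\<dots> = (real d\<^sub>H + 1) * A + (real d\<^sub>G + 1) * B - p * q"
    by (simp add: sum.distrib sum_subtractf card A_def pq flip: sum_distrib_left sum_distrib_right)
  finally have C: "C \<le> (real d\<^sub>H + 1) * A + (real d\<^sub>G + 1) * B - p * q" .
  have pos: "real d\<^sub>G > 0" "real d\<^sub>H > 0" "real D > 0"
    using G.degree_pos H.degree_pos P.degree_pos by auto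
  have "real (d\<^sub>H * (d\<^sub>G + 1)) / D * LLY_curvature H y\<^sub>1 y\<^sub>2
      = (real d\<^sub>G + 1) * (real d\<^sub>H + 1 - B) / D"
    unfolding LH using pos by (simp add: field_simps)
  moreover have "real (d\<^sub>G * (d\<^sub>H + 1)) / D * LLY_curvature G x\<^sub>1 x\<^sub>2
      = (real d\<^sub>H + 1) * (real d\<^sub>G + 1 - A) / D"
    unfolding LG using pos by (simp add: field_simps)
  moreover have "1 - (p * q - 1) / D = (real D - (p * q - 1)) / D"
    using pos by (simp add: diff_divide_distrib)
  ultimately have "real (d\<^sub>H * (d\<^sub>G + 1)) / D * LLY_curvature H y\<^sub>1 y\<^sub>2
      + real (d\<^sub>G * (d\<^sub>H + 1)) / D * LLY_curvature G x\<^sub>1 x\<^sub>2 - (1 - (p * q - 1) / D)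
    = ((real d\<^sub>G + 1) * (real d\<^sub>H + 1 - B) + (real d\<^sub>H + 1) * (real d\<^sub>G + 1 - A)
      - (real D - (p * q - 1))) / D"
    by (simp only: add_divide_distrib diff_divide_distrib)
  \<comment> \<open>As \<open>(d\<^sub>G + 1) * (d\<^sub>H + 1) = D + 1\<close>, the numerator on
    the left is \<open>D + 1\<close> minus the bound on \<open>C\<close>; the term \<open>X\<close>
    absorbs the surplus \<open>D + 1\<close> and the saving \<open>p * q\<close>.\<close>
  also have "\<dots> \<le> (real D + 1 - C) / D"
    using C pos by (intro divide_right_mono) (simp_all add: D_def algebra_simps)
  also note LP
  finally show ?thesis unfolding Let_def D_def p_def q_def .
qed

end
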